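(* Let $f:[0,1]\to[0,1]$ be a homeomorphism whose non-wandering set $NW(f)$ is finite. Then $h_{pol}(C(f))=2$, $h_{pol}(f^{*k})=k$ for every integer $k\ge 1$, and $h_{pol}(2^f)=\infty$.
   Context: **Non-wandering set.** For a continuous map $f:X\to X$ of a compact metric space, a point $p\in X$ is wandering if there is a neighbourhood $U\ni p$ with $f^n(U)\cap U=\emptyset$ for all $n\ge 1$. A point that is not wandering is non-wandering, and $NW(f)$ is the set of non-wandering points. **Hyperspaces.** For a compact metric space $(X,d)$, $2^X$ is the set of all nonempty closed subsets of $X$, with the Hausdorff metric $d_H(A,B)=\inf\{\varepsilon>0 \mid A\subset U(B,\varepsilon),\ B\subset U(A,\varepsilon)\}$, where $U(A,\varepsilon)=\{x\in X\mid d(x,A)<\varepsilon\}$. For $k\in\mathbb{N}$, $k\geq 1$, $X^{*k}\subset 2^X$ is the subspace of all nonempty subsets of $X$ with at most $k$ points. If $X$ is connected, $C(X)\subset 2^X$ is the subspace of all nonempty closed connected subsets of $X$ (one-point sets and $X$ itself are included). All of these carry the metric $d_H$. **Induced maps.** A continuous $f:X\to X$ induces continuous maps $2^f:2^X\to 2^X$, $C(f):C(X)\to C(X)$ and $f^{*k}:X^{*k}\to X^{*k}$, each given by $A\mapsto f(A)=\{f(x)\mid x\in A\}$. **Polynomial entropy.** For a continuous map $g:Z\to Z$ of a compact metric space $(Z,d)$, let $d_n^g(x,y)=\max_{0\le j\le n-1}d(g^j(x),g^j(y))$. A finite set $E\subset Z$ is $(n,\varepsilon)$-separated if $d_n^g(x,y)\ge\varepsilon$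 for all distinct $x,y\in E$. Let $S(n,\varepsilon;Z)$ be the maximal cardinality of an $(n,\varepsilon)$-separated subset of $Z$. Then $$h_{pol}(g)=\lim_{\varepsilon\to 0}\limsup_{n\to\infty}\frac{\log S(n,\varepsilon;Z)}{\log n}.$$ *)

theory Defs
  imports "HOL-Analysis.Analysis"
begin

text \<open>Spaces are carrier sets, and a self-map of the space \<open>X\<close> is a total function of which only
  the values on \<open>X\<close> matter; neighbourhoods and closed sets are taken relative to \<open>X\<close>.\<close>

definition wandering :: "'a::topological_space set \<Rightarrow> ('a \<Rightarrow> 'a) \<Rightarrow> 'a \<Rightarrow> bool" where
  "wandering X f p \<longleftrightarrow>
     (\<exists>U. openin (top_of_set X) U \<and> p \<in> U \<and> (\<forall>n\<ge>1. (f ^^ n) ` U \<inter> U = {}))"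

definition NW :: "'a::topological_space set \<Rightarrow> ('a \<Rightarrow> 'a) \<Rightarrow> 'a set" where
  "NW X f = {p \<in> X. \<not> wandering X f p}"

definition hyperspace :: "'a::topological_space set \<Rightarrow> 'a set set" where
  "hyperspace X = {A. A \<noteq> {} \<and> closedin (top_of_set X) A}"

definition continua :: "'a::topological_space set \<Rightarrow> 'a set set" where
  "continua X = {A \<in> hyperspace X. connected A}"

definition symmetric_product :: "nat \<Rightarrow> 'a set \<Rightarrow> 'a set set" where
  "symmetric_product k X = {A. A \<noteq> {} \<and> A \<subseteq> X \<and> finite A \<and> card A \<le> k}"

definition set_nbhd :: "'a::metric_space set \<Rightarrow> real \<Rightarrow> 'a set" where
  "set_nbhd A \<epsilon> = {x. infdist x A < \<epsilon>}"

text \<open>\<^const>\<open>set_nbhd\<close> is taken in the ambient type, which does not change the inclusions below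
  for subsets of a carrier \<open>X\<close>. The distance is meant for nonempty bounded sets only.\<close>

definition hausdorff_dist :: "'a::metric_space set \<Rightarrow> 'a set \<Rightarrow> real" where
  "hausdorff_dist A B = Inf {\<epsilon>. \<epsilon> > 0 \<and> A \<subseteq> set_nbhd B \<epsilon> \<and> B \<subseteq> set_nbhd A \<epsilon>}"

text \<open>The dynamical notions take the carrier \<open>Z\<close> and the metric \<open>d\<close> explicitly, since the
  hyperspaces are not types. The map induced by \<open>f\<close> on any of them is \<open>image f\<close>.\<close>

definition dyn_dist :: "('b \<Rightarrow> 'b \<Rightarrow> real) \<Rightarrow> ('b \<Rightarrow> 'b) \<Rightarrow> nat \<Rightarrow> 'b \<Rightarrow> 'b \<Rightarrow> real" where
  "dyn_dist d g n x y = Max ((\<lambda>j. d ((g ^^ j) x) ((g ^^ j) y)) ` {..<n})"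

definition separated_set ::
  "'b set \<Rightarrow> ('b \<Rightarrow> 'b \<Rightarrow> real) \<Rightarrow> ('b \<Rightarrow> 'b) \<Rightarrow> nat \<Rightarrow> real \<Rightarrow> 'b set \<Rightarrow> bool" where
  "separated_set Z d g n \<epsilon> E \<longleftrightarrow>
     finite E \<and> E \<subseteq> Z \<and> (\<forall>x\<in>E. \<forall>y\<in>E. x \<noteq> y \<longrightarrow> dyn_dist d g n x y \<ge> \<epsilon>)"

text \<open>For \<open>n \<ge> 1\<close>, \<open>\<epsilon> > 0\<close>, compact \<open>Z\<close> and continuous \<open>g\<close> the cardinalities below are bounded, so
  the maximum exists; it is then antitone in \<open>\<epsilon>\<close>, so the limit in the entropy exists in the extended
  reals.\<close>

definition sep_number ::
  "'b set \<Rightarrow> ('b \<Rightarrow> 'b \<Rightarrow> real) \<Rightarrow> ('b \<Rightarrow> 'b) \<Rightarrow> nat \<Rightarrow> real \<Rightarrow> nat" where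
  "sep_number Z d g n \<epsilon> = Max {card E |E. separated_set Z d g n \<epsilon> E}"

definition pol_entropy :: "'b set \<Rightarrow> ('b \<Rightarrow> 'b \<Rightarrow> real) \<Rightarrow> ('b \<Rightarrow> 'b) \<Rightarrow> ereal" where
  "pol_entropy Z d g =
     Lim (at_right 0)
       (\<lambda>\<epsilon>. limsup (\<lambda>n. ereal (ln (real (sep_number Z d g n \<epsilon>)) / ln (real n))))"

end

theory Submission
  imports Defs
begin

text \<open>Upper bounds: a monotone \<open>f\<close> has only \<open>O(n)\<close> itineraries of length \<open>n\<close> with respect to a fixed
  grid, and a closed set is determined up to \<open>\<epsilon>\<close> and for time \<open>n\<close> by the set of itineraries of its
  points: at most \<open>O(n)\<^sup>k\<close> choices for \<open>k\<close>-point sets, and \<open>O(n)\<^sup>2\<close> for intervals, where the itineraries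
  of the endpoints suffice.

  Lower bounds: every fixed point of \<open>f \<circ> f\<close> is non-wandering, so some \<open>x\<close> is moved by \<open>f \<circ> f\<close>. By
  monotonicity all other points of the orbit of \<open>x\<close> under \<open>f \<circ> f\<close> stay away from \<open>x\<close>, so the sets of
  \<open>k\<close> preimages of \<open>x\<close> under even iterates of \<open>f\<close> are separated as soon as each of them has returned
  to \<open>x\<close>. This gives about \<open>(n/2 choose k)\<close> separated sets, and for \<open>k = 2\<close> their convex hulls are
  separated as well.\<close>


subsection \<open>Growth rates\<close>

text \<open>After division by ln n the constant contributes only ln c / ln n, which tends to 0, so
  the exponent alone survives in the limit.\<close>

lemma limsup_ge_of_power_le:
  fixes S :: "nat \<Rightarrow> nat"
  assumes c: "c > 0" and S: "\<forall>\<^sub>F n in sequentially. c * real n ^ k \<le> real (S n)"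
  shows "ereal (real k) \<le> limsup (\<lambda>n. ereal (ln (real (S n)) / ln (real n)))"
proof -
  have "(\<lambda>n. ln c / ln (real n) + real k) \<longlonglongrightarrow> 0 + real k"
    by (intro tendsto_intros tendsto_divide_0[OF tendsto_const] filterlim_at_top_imp_at_infinity
        filterlim_compose[OF ln_at_top] filterlim_real_sequentially)
  then have lim: "limsup (\<lambda>n. ereal (ln c / ln (real n) + real k)) = ereal (real k)"
    by (intro lim_imp_Limsup) auto
  have "\<forall>\<^sub>F n in sequentially.
      ereal (ln c / ln (real n) + real k) \<le> ereal (ln (real (S n)) / ln (real n))"
    using S eventually_ge_at_top[of 2]
  proof eventually_elim
    case (elim n)
    then have "ln (c * real n ^ k) \<le> ln (real (S n))"
      using c by (intro ln_mono) auto
    then have "ln c + real k * ln (real n) \<le> ln (real (S n))"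
      using c elim by (simp add: ln_mult ln_realpow)
    moreover have "ln (real n) > 0"
      using elim by simp
    moreover from this have "ln c / ln (real n) + real k = (ln c + real k * ln (real n)) / ln (real n)"
      by (simp add: add_divide_distrib)
    ultimately show ?case
      by (simp add: divide_right_mono)
  qed
  from Limsup_mono[OF this] show ?thesis
    unfolding lim .
qed

lemma limsup_le_of_le_power:
  fixes S :: "nat \<Rightarrow> nat"
  assumes C: "C > 0" and S: "\<forall>\<^sub>F n in sequentially. 0 < S n \<and> real (S n) \<le> C * real n ^ k"
  shows "limsup (\<lambda>n. ereal (ln (real (S n)) / ln (real n))) \<le> ereal (real k)"
proof -
  have "(\<lambda>n. ln C / ln (real n) + real k) \<longlonglongrightarrow> 0 + real k"
    by (intro tendsto_intros tendsto_divide_0[OF tendsto_const] filterlim_at_top_imp_at_infinity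
        filterlim_compose[OF ln_at_top] filterlim_real_sequentially)
  then have lim: "limsup (\<lambda>n. ereal (ln C / ln (real n) + real k)) = ereal (real k)"
    by (intro lim_imp_Limsup) auto
  have "\<forall>\<^sub>F n in sequentially.
      ereal (ln (real (S n)) / ln (real n)) \<le> ereal (ln C / ln (real n) + real k)"
    using S eventually_ge_at_top[of 2]
  proof eventually_elim
    case (elim n)
    then have "ln (real (S n)) \<le> ln (C * real n ^ k)"
      using C by (intro ln_mono) auto
    then have "ln (real (S n)) \<le> ln C + real k * ln (real n)"
      using C elim by (simp add: ln_mult ln_realpow)
    moreover have "ln (real n) > 0"
      using elim by simp
    moreover from this have "ln C / ln (real n) + real k = (ln C + real k * ln (real n)) / ln (real n)"
      by (simp add: add_divide_distrib)
    ultimately show ?case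
      by (simp add: divide_right_mono)
  qed
  from Limsup_mono[OF this] show ?thesis
    unfolding lim .
qed

lemma limsup_ge_of_choose_le:
  fixes S :: "nat \<Rightarrow> nat"
  assumes k: "k \<ge> 1" and S: "\<And>n. n > 0 \<Longrightarrow> n div 2 choose k \<le> S n"
  shows "ereal (real k) \<le> limsup (\<lambda>n. ereal (ln (real (S n)) / ln (real n)))"
proof (rule limsup_ge_of_power_le)
  \<comment> \<open>The constant comes from (m choose k) >= (m / k)^k with m = n div 2. The 4 in
    place of 2 absorbs the rounding, since n div 2 >= n / 4 for n >= 2; and n >= 2 * k makes k <= m,
    as the binomial bound requires.\<close>
  show "(1 / (4 * real k)) ^ k > 0"
    using k by simp
  show "\<forall>\<^sub>F n in sequentially. (1 / (4 * real k)) ^ k * real n ^ k \<le> real (S n)"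
    using eventually_ge_at_top[of "2 * k"]
  proof eventually_elim
    case (elim n)
    have n: "n \<ge> 2" "n div 2 \<ge> k"
      using elim k by linarith+
    have "real n / 4 \<le> real (n div 2)"
      using n by linarith
    then have "1 / (4 * real k) * real n \<le> real (n div 2) / real k"
      using k by (simp add: field_simps)
    then have "(1 / (4 * real k) * real n) ^ k \<le> (real (n div 2) / real k) ^ k"
      by (intro power_mono) auto
    also have "\<dots> \<le> real (n div 2 choose k)"
      using n by (intro binomial_ge_n_over_k_pow_k)
    also have "\<dots> \<le> real (S n)"
      using S[of n] n by simp
    finally show ?case
      by (simp only: power_mult_distrib)
  qed
qed

lemma limsup_eq_of_choose_le:
  fixes S :: "nat \<Rightarrow> nat"
  assumes k: "k \<ge> 1" and S: "\<And>n. n > 0 \<Longrightarrow> n div 2 choose k \<le> S n"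
    and K: "K > 0" "\<And>n. n > 0 \<Longrightarrow> real (S n) \<le> (K * real n) ^ k"
  shows "limsup (\<lambda>n. ereal (ln (real (S n)) / ln (real n))) = ereal (real k)"
proof (rule antisym)
  show "limsup (\<lambda>n. ereal (ln (real (S n)) / ln (real n))) \<le> ereal (real k)"
  proof (rule limsup_le_of_le_power)
    show "K ^ k > 0"
      using K by simp
    show "\<forall>\<^sub>F n in sequentially. 0 < S n \<and> real (S n) \<le> K ^ k * real n ^ k"
      using eventually_ge_at_top[of "2 * k"]
    proof eventually_elim
      case (elim n)
      have n: "n > 0" "n div 2 \<ge> k"
        using elim k by linarith+
      \<comment> \<open>Taking logarithms in the upper bound needs S n > 0; the binomial supplies
        this, since k <= n div 2.\<close>
      have "0 < n div 2 choose k"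
        using n by (simp add: zero_less_binomial_iff)
      then show ?case
        using S[of n] K(2)[of n] n by (auto simp: power_mult_distrib simp del: zero_less_binomial_iff)
    qed
  qed
qed (rule limsup_ge_of_choose_le[OF k S])

text \<open>In all three cases the limsup takes its final value as soon as \<epsilon> \<le> e, so
  the outer limit is that of a function constant near 0.\<close>

lemma pol_entropy_eqI:
  assumes "e > 0"
    and "\<And>\<epsilon>. 0 < \<epsilon> \<Longrightarrow> \<epsilon> \<le> e \<Longrightarrow>
      limsup (\<lambda>n. ereal (ln (real (sep_number Z d g n \<epsilon>)) / ln (real n))) = L"
  shows "pol_entropy Z d g = L"
  unfolding pol_entropy_def
proof (intro tendsto_Lim tendsto_eventually)
  show "\<forall>\<^sub>F \<epsilon> in at_right 0.
      limsup (\<lambda>n. ereal (ln (real (sep_number Z d g n \<epsilon>)) / ln (real n))) = L"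
    by (rule eventually_at_rightI[of 0 e]) (use assms in auto)
qed auto


subsection \<open>Separated sets and codes\<close>

lemma dyn_dist_ge: "i < n \<Longrightarrow> e \<le> d ((g ^^ i) x) ((g ^^ i) y) \<Longrightarrow> e \<le> dyn_dist d g n x y"
  unfolding dyn_dist_def by (subst Max_ge_iff) auto

lemma dyn_dist_less:
  assumes "n > 0" "\<And>i. i < n \<Longrightarrow> d ((g ^^ i) x) ((g ^^ i) y) < e"
  shows "dyn_dist d g n x y < e"
  unfolding dyn_dist_def using assms by (subst Max_less_iff) auto

lemma separated_set_card_le_code:
  assumes "finite (c ` Z)"
    and "\<And>x y. x \<in> Z \<Longrightarrow> y \<in> Z \<Longrightarrow> c x = c y \<Longrightarrow> dyn_dist d g n x y < \<epsilon>"
    and "separated_set Z d g n \<epsilon> E"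
  shows "card E \<le> card (c ` Z)"
proof -
  have "inj_on c E"
    using assms(2,3) unfolding separated_set_def inj_on_def by (meson not_less subsetD)
  then show ?thesis
    using assms(1,3) unfolding separated_set_def by (meson card_inj_on_le image_mono)
qed

lemma sep_number_le_card_code:
  assumes "finite (c ` Z)"
    and "\<And>x y. x \<in> Z \<Longrightarrow> y \<in> Z \<Longrightarrow> c x = c y \<Longrightarrow> dyn_dist d g n x y < \<epsilon>"
  shows "sep_number Z d g n \<epsilon> \<le> card (c ` Z)"
proof -
  let ?K = "{card E |E. separated_set Z d g n \<epsilon> E}"
  have le: "\<forall>m\<in>?K. m \<le> card (c ` Z)"
    using separated_set_card_le_code[of c Z d g n \<epsilon>, OF assms] by blast
  then have "finite ?K"
    by (meson finite_nat_set_iff_bounded_le)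
  moreover have "?K \<noteq> {}"
    unfolding separated_set_def by blast
  ultimately show ?thesis
    unfolding sep_number_def using le by simp
qed

text \<open>\<open>Max\<close> dominates the members of a set of naturals only when that set is
  finite, so even a lower bound needs a finite code. The code also makes \<open>a\<close> injective:
  equal values have equal codes, so they would be both closer than \<epsilon> and
  \<epsilon>-separated.\<close>

lemma card_le_sep_number:
  assumes "finite (c ` Z)"
    and "\<And>x y. x \<in> Z \<Longrightarrow> y \<in> Z \<Longrightarrow> c x = c y \<Longrightarrow> dyn_dist d g n x y < \<epsilon>"
    and "finite I" "a ` I \<subseteq> Z"
    and sep: "\<And>i j. i \<in> I \<Longrightarrow> j \<in> I \<Longrightarrow> i \<noteq> j \<Longrightarrow> \<epsilon> \<le> dyn_dist d g n (a i) (a j)"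
  shows "card I \<le> sep_number Z d g n \<epsilon>"
proof -
  let ?K = "{card E |E. separated_set Z d g n \<epsilon> E}"
  have "\<forall>m\<in>?K. m \<le> card (c ` Z)"
    using separated_set_card_le_code[of c Z d g n \<epsilon>, OF assms(1,2)] by blast
  then have "finite ?K"
    by (meson finite_nat_set_iff_bounded_le)
  moreover have "inj_on a I"
  proof (rule inj_onI, rule ccontr)
    fix i j assume ij: "i \<in> I" "j \<in> I" "a i = a j" "i \<noteq> j"
    then show False
      using sep[of i j] assms(2)[of "a i" "a j"] assms(4) by auto
  qed
  then have "card (a ` I) = card I"
    by (rule card_image)
  moreover have "separated_set Z d g n \<epsilon> (a ` I)"
    using assms(3,4) sep unfolding separated_set_def by fastforce
  ultimately show ?thesis
    unfolding sep_number_def by (metis (mono_tags, lifting) Max_ge mem_Collect_eq)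
qed

lemma funpow_image:
  fixes f :: "'a \<Rightarrow> 'a"
  shows "((`) f ^^ n) A = (f ^^ n) ` A"
  by (induction n) (auto simp: image_comp)


subsection \<open>The Hausdorff distance\<close>

text \<open>The bound is non-strict because \<delta> is merely one of the admissible radii;
  \<open>set_code\<close> regains strictness from 1 / N < \<epsilon>.\<close>

lemma hausdorff_dist_le:
  assumes "0 < \<delta>"
    and "\<And>x. x \<in> A \<Longrightarrow> \<exists>y\<in>B. dist x y < \<delta>"
    and "\<And>y. y \<in> B \<Longrightarrow> \<exists>x\<in>A. dist y x < \<delta>"
  shows "hausdorff_dist A B \<le> \<delta>"
  unfolding hausdorff_dist_def
proof (rule cInf_lower)
  show "\<delta> \<in> {\<epsilon>. \<epsilon> > 0 \<and> A \<subseteq> set_nbhd B \<epsilon> \<and> B \<subseteq> set_nbhd A \<epsilon>}"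
    using assms infdist_le[THEN le_less_trans] unfolding set_nbhd_def by blast
  show "bdd_below {\<epsilon>. \<epsilon> > 0 \<and> A \<subseteq> set_nbhd B \<epsilon> \<and> B \<subseteq> set_nbhd A \<epsilon>}"
    by (rule bdd_belowI[of _ 0]) auto
qed

lemma hausdorff_dist_commute: "hausdorff_dist A B = hausdorff_dist B A"
  unfolding hausdorff_dist_def by (simp add: conj_commute)

text \<open>One point of \<open>A\<close> far from all of \<open>B\<close> already excludes every
  radius below e. Boundedness and nonemptiness ensure that some radius is admissible at all, since
  \<open>Inf\<close> of the empty set would give no bound.\<close>

lemma hausdorff_dist_ge:
  assumes "bounded A" "bounded B" "x \<in> A" "B \<noteq> {}"
    and far: "\<And>y. y \<in> B \<Longrightarrow> e \<le> dist x y"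
  shows "e \<le> hausdorff_dist A B"
  unfolding hausdorff_dist_def
proof (rule cInf_greatest)
  obtain b where b: "b \<in> B"
    using assms by auto
  obtain D where D: "\<And>u v. u \<in> A \<union> B \<Longrightarrow> v \<in> A \<union> B \<Longrightarrow> dist u v \<le> D"
    using assms(1,2) by (metis bounded_Un bounded_two_points)
  \<comment> \<open>A bound D on the pairwise distances yields the admissible radius |D| + 1; the
    added 1 makes the inequalities strict.\<close>
  then have "infdist u B < \<bar>D\<bar> + 1" if "u \<in> A" for u
    using infdist_le[OF b, of u] D[of u b] that b by force
  moreover have "infdist u A < \<bar>D\<bar> + 1" if "u \<in> B" for u
    using infdist_le[OF assms(3), of u] D[of u x] that assms(3) by force
  ultimately show "{\<epsilon>. \<epsilon> > 0 \<and> A \<subseteq> set_nbhd B \<epsilon> \<and> B \<subseteq> set_nbhd A \<epsilon>} \<noteq> {}"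
    unfolding set_nbhd_def by (auto intro!: exI[of _ "\<bar>D\<bar> + 1"])
  fix \<epsilon> assume "\<epsilon> \<in> {\<epsilon>. \<epsilon> > 0 \<and> A \<subseteq> set_nbhd B \<epsilon> \<and> B \<subseteq> set_nbhd A \<epsilon>}"
  then have "infdist x B < \<epsilon>"
    using assms(3) unfolding set_nbhd_def by auto
  moreover have "e \<le> infdist x B"
    unfolding infdist_def using assms(4) far by (auto intro: cINF_greatest)
  ultimately show "e \<le> \<epsilon>"
    by simp
qed


subsection \<open>Monotone interval maps\<close>

lemma sum_mono_on:
  fixes g :: "'i \<Rightarrow> 'a::order \<Rightarrow> 'b::ordered_comm_monoid_add"
  assumes "\<And>i. i \<in> I \<Longrightarrow> mono_on S (g i)"
  shows "mono_on S (\<lambda>x. \<Sum>i\<in>I. g i x)"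
  using assms by (auto intro!: monotone_onI sum_mono dest: monotone_onD)

text \<open>A monotone map moves the points of an orbit in one direction only, so no later point is
  closer to x than the first iterate.\<close>

lemma mono_on_funpow_displacement:
  fixes g :: "real \<Rightarrow> real"
  assumes g: "mono_on S g" "g ` S \<subseteq> S" and "x \<in> S" "n \<ge> 1"
  shows "\<bar>g x - x\<bar> \<le> \<bar>(g ^^ n) x - x\<bar>"
proof -
  \<comment> \<open>The induction step applies g to x \<le> \<open>(g ^^ n) x\<close>, which gives g
    x \<le> \<open>(g ^^ Suc n) x\<close>, and symmetrically when g x \<le> x.\<close>
  have *: "(g ^^ n) x \<in> S \<and> (x \<le> g x \<longrightarrow> g x \<le> (g ^^ n) x) \<and> (g x \<le> x \<longrightarrow> (g ^^ n) x \<le> g x)"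
    using \<open>n \<ge> 1\<close>
  proof (induction n rule: dec_induct)
    case base
    then show ?case
      using assms by auto
  next
    case (step n)
    then show ?case
      using monotone_onD[OF g(1), of x "(g ^^ n) x"] monotone_onD[OF g(1), of "(g ^^ n) x" x]
        g(2) \<open>x \<in> S\<close>
      by auto
  qed
  then show ?thesis
    by (cases "x \<le> g x") auto
qed

locale monotone_interval_map =
  fixes f :: "real \<Rightarrow> real"
  assumes into: "f ` {0..1} \<subseteq> {0..1}"
    and monotone: "mono_on {0..1} f \<or> antimono_on {0..1} f"
begin

lemma funpow_into:
  assumes "x \<in> {0..1}"
  shows "(f ^^ n) x \<in> {0..1}"
proof (induction n)
  case (Suc n)
  then show ?case
    using into by (simp del: atLeastAtMost_iff) blast
qed (use assms in simp)

lemma funpow_monotone: "mono_on {0..1} (f ^^ n) \<or> antimono_on {0..1} (f ^^ n)"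
proof (induction n)
  case 0
  then show ?case
    by (auto intro: monotone_onI)
next
  case (Suc n)
  have "(f ^^ n) x \<in> {0..1}" if "x \<in> {0..1}" for x
    using funpow_into that .
  then show ?case
    using Suc monotone unfolding monotone_on_def by (auto simp del: atLeastAtMost_iff)
qed

text \<open>Whether f preserves or reverses order, its square preserves it. The lower bounds
  therefore observe only even times, which is why they have n div 2 in place of n.\<close>

lemma funpow2_mono: "mono_on {0..1} (f ^^ 2)"
proof -
  have "f x \<in> {0..1}" if "x \<in> {0..1}" for x
    using into that by blast
  then show ?thesis
    using monotone unfolding monotone_on_def
    by (auto simp: numeral_2_eq_2 simp del: atLeastAtMost_iff)
qed

lemma funpow_even_mono: "mono_on {0..1} (f ^^ (2 * n))"
proof (induction n)
  case 0
  then show ?case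
    by (auto intro: monotone_onI)
next
  case (Suc n)
  have "f ^^ (2 * Suc n) = (f ^^ 2) \<circ> (f ^^ (2 * n))"
    by (metis funpow_add mult_Suc_right)
  moreover have "(f ^^ (2 * n)) x \<in> {0..1}" if "x \<in> {0..1}" for x
    using funpow_into that .
  ultimately show ?case
    using Suc funpow2_mono unfolding monotone_on_def by (auto simp del: atLeastAtMost_iff)
qed

text \<open>Summing the itinerary with signs turns it into a single monotone integer, and equal sums of
  termwise ordered itineraries force equal itineraries. This is why there are only linearly many.\<close>

lemma itinerary_code:
  fixes N n :: nat
  assumes "N > 0"
  obtains \<phi> :: "real \<Rightarrow> int" where
    "mono_on {0..1} \<phi>"
    "\<phi> ` {0..1} \<subseteq> {- int (n * N)..int (n * N)}"
    "\<And>x y i. x \<in> {0..1} \<Longrightarrow> y \<in> {0..1} \<Longrightarrow> \<phi> x = \<phi> y \<Longrightarrow> i < n \<Longrightarrow>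
      dist ((f ^^ i) x) ((f ^^ i) y) < 1 / real N"
proof -
  \<comment> \<open>The sign makes each summand nondecreasing even if \<open>f ^^ i\<close> reverses
    order; the floor in \<open>p\<close> is the index of the cell of length 1 / N that contains the
    point at time i.\<close>
  define s :: "nat \<Rightarrow> int" where "s i = (if mono_on {0..1} (f ^^ i) then 1 else -1)" for i
  define p where "p i x = s i * \<lfloor>real N * (f ^^ i) x\<rfloor>" for i x
  define \<phi> where "\<phi> x = (\<Sum>i<n. p i x)" for x
  have p_mono: "mono_on {0..1} (p i)" for i
  proof (cases "mono_on {0..1} (f ^^ i)")
    case True
    then show ?thesis
      unfolding p_def s_def monotone_on_def by (auto intro!: floor_mono mult_left_mono)
  next
    case False
    then have "antimono_on {0..1} (f ^^ i)"
      using funpow_monotone by blast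
    then show ?thesis
      using False unfolding p_def s_def monotone_on_def
      by (auto intro!: floor_mono mult_left_mono)
  qed
  have \<phi>_mono: "mono_on {0..1} \<phi>"
    unfolding \<phi>_def by (intro sum_mono_on p_mono)
  have p_bound: "\<bar>p i x\<bar> \<le> int N" if "x \<in> {0..1}" for i x
  proof -
    have "0 \<le> real N * (f ^^ i) x" "real N * (f ^^ i) x \<le> real N"
      using funpow_into[OF that, of i] by (auto intro: mult_left_le)
    then have "0 \<le> \<lfloor>real N * (f ^^ i) x\<rfloor>" "\<lfloor>real N * (f ^^ i) x\<rfloor> \<le> int N"
      by (auto simp: floor_le_iff)
    then show ?thesis
      unfolding p_def s_def by auto
  qed
  have bound: "\<phi> ` {0..1} \<subseteq> {- int (n * N)..int (n * N)}"
  proof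
    fix v assume "v \<in> \<phi> ` {0..1}"
    then obtain x where x: "x \<in> {0..1}" "v = \<phi> x"
      by auto
    have "\<bar>\<phi> x\<bar> \<le> (\<Sum>i<n. \<bar>p i x\<bar>)"
      unfolding \<phi>_def by (rule sum_abs)
    also have "\<dots> \<le> (\<Sum>i<n. int N)"
      by (intro sum_mono p_bound x)
    finally show "v \<in> {- int (n * N)..int (n * N)}"
      using x by auto
  qed
  have close: "dist ((f ^^ i) x) ((f ^^ i) y) < 1 / real N"
    if "x \<in> {0..1}" "y \<in> {0..1}" "\<phi> x = \<phi> y" "i < n" "x \<le> y" for x y i
  proof -
    have "p i x = p i y"
    proof (rule sum_mono_inv[of "\<lambda>i. p i x" "{..<n}" "\<lambda>i. p i y"])
      show "(\<Sum>i<n. p i x) = (\<Sum>i<n. p i y)"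
        using that unfolding \<phi>_def by simp
    qed (use that monotone_onD[OF p_mono] in auto)
    then have "\<lfloor>real N * (f ^^ i) x\<rfloor> = \<lfloor>real N * (f ^^ i) y\<rfloor>"
      unfolding p_def s_def by (auto split: if_splits)
    then have "\<bar>real N * (f ^^ i) x - real N * (f ^^ i) y\<bar> < 1"
      by linarith
    then have "real N * \<bar>(f ^^ i) x - (f ^^ i) y\<bar> < 1"
      by (simp add: abs_mult flip: right_diff_distrib)
    then show ?thesis
      using assms by (simp add: dist_real_def field_simps)
  qed
  show ?thesis
  proof (rule that[OF \<phi>_mono bound])
    fix x y i assume "x \<in> {0..1}" "y \<in> {0..1}" "\<phi> x = \<phi> y" "i < n"
    then show "dist ((f ^^ i) x) ((f ^^ i) y) < 1 / real N"
      using close[of x y i] close[of y x i] by (cases "x \<le> y") (auto simp: dist_commute)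
  qed
qed

section \<open>Coding subsets of the interval by sets of itineraries\<close>

text \<open>With equal codes, every point of either set has a partner in the other with the same
  itinerary, hence within 1 / N of it at all times below n. This bounds the Hausdorff distance by 1
  / N < \<epsilon>. K is chosen before n, so the number of point codes grows at most
  linearly.\<close>

lemma set_code:
  assumes "\<epsilon> > 0"
  obtains K :: real and \<phi> :: "nat \<Rightarrow> real \<Rightarrow> int" where
    "K > 0"
    "\<And>n. mono_on {0..1} (\<phi> n)"
    "\<And>n. finite (\<phi> n ` {0..1})"
    "\<And>n. n > 0 \<Longrightarrow> real (card (\<phi> n ` {0..1})) \<le> K * real n"
    "\<And>n A B. n > 0 \<Longrightarrow> A \<subseteq> {0..1} \<Longrightarrow> B \<subseteq> {0..1} \<Longrightarrow> \<phi> n ` A = \<phi> n ` B \<Longrightarrow>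
      dyn_dist hausdorff_dist (image f) n A B < \<epsilon>"
proof -
  obtain N :: nat where N: "N > 0" "1 / real N < \<epsilon>"
    using assms by (metis inverse_eq_divide reals_Archimedean zero_less_Suc)
  have "\<exists>\<phi> :: real \<Rightarrow> int. mono_on {0..1} \<phi> \<and> \<phi> ` {0..1} \<subseteq> {- int (n * N)..int (n * N)} \<and>
      (\<forall>x y i. x \<in> {0..1} \<longrightarrow> y \<in> {0..1} \<longrightarrow> \<phi> x = \<phi> y \<longrightarrow> i < n \<longrightarrow>
        dist ((f ^^ i) x) ((f ^^ i) y) < 1 / real N)" for n
    by (rule itinerary_code[OF N(1), of n]) blast
  then obtain \<phi> :: "nat \<Rightarrow> real \<Rightarrow> int" where
    mono: "\<And>n. mono_on {0..1} (\<phi> n)" and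
    bound: "\<And>n. \<phi> n ` {0..1} \<subseteq> {- int (n * N)..int (n * N)}" and
    close: "\<And>n x y i. x \<in> {0..1} \<Longrightarrow> y \<in> {0..1} \<Longrightarrow> \<phi> n x = \<phi> n y \<Longrightarrow> i < n \<Longrightarrow>
        dist ((f ^^ i) x) ((f ^^ i) y) < 1 / real N"
    by metis
  have fin: "finite (\<phi> n ` {0..1})" for n
    using bound finite_subset by blast
  have card: "real (card (\<phi> n ` {0..1})) \<le> real (2 * N + 1) * real n" if "n > 0" for n
  proof -
    have "card (\<phi> n ` {0..1}) \<le> card {- int (n * N)..int (n * N)}"
      by (intro card_mono bound) auto
    also have "\<dots> = 2 * n * N + 1"
      by (simp add: nat_eq_iff)
    \<comment> \<open>Here n \<ge> 1 absorbs the summand 1, which gives K = 2 * N + 1.\<close>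
    also have "\<dots> \<le> (2 * N + 1) * n"
      using that by (simp add: algebra_simps)
    finally show ?thesis
      by (metis of_nat_le_iff of_nat_mult)
  qed
  have small: "dyn_dist hausdorff_dist (image f) n A B < \<epsilon>"
    if n: "n > 0" and AB: "A \<subseteq> {0..1}" "B \<subseteq> {0..1}" and eq: "\<phi> n ` A = \<phi> n ` B" for n A B
  proof (rule dyn_dist_less[OF n])
    fix i assume i: "i < n"
    have near: "\<exists>y\<in>(f ^^ i) ` B'. dist x y < 1 / real N"
      if x: "x \<in> (f ^^ i) ` A'" and sub: "A' \<subseteq> {0..1}" "B' \<subseteq> {0..1}"
        and eq': "\<phi> n ` A' = \<phi> n ` B'" for A' B' x
    proof -
      obtain u where u: "u \<in> A'" "x = (f ^^ i) u"
        using x by blast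
      then obtain v where v: "v \<in> B'" "\<phi> n u = \<phi> n v"
        using eq' by blast
      then have "dist x ((f ^^ i) v) < 1 / real N"
        using u sub close[of u v n i] i by blast
      then show ?thesis
        using v by blast
    qed
    have "hausdorff_dist ((f ^^ i) ` A) ((f ^^ i) ` B) \<le> 1 / real N"
      using N(1) near[OF _ AB eq] near[OF _ AB(2,1) eq[symmetric]]
      by (intro hausdorff_dist_le) auto
    then show "hausdorff_dist (((`) f ^^ i) A) (((`) f ^^ i) B) < \<epsilon>"
      using N by (simp add: funpow_image)
  qed
  show ?thesis
    by (rule that[OF _ mono fin card small]) auto
qed

section \<open>A criterion for lower bounds\<close>

text \<open>Distinct finite sets T and T' of equal size do not contain one another, so some t lies
  in T but not in T'. Since t < n div 2, the time 2 * t at which their images are far apart is below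
  n.\<close>

lemma choose_le_sep_number:
  assumes "0 < \<epsilon>" "\<epsilon> \<le> e" "n > 0" "Z \<subseteq> Pow {0..1}"
    and a: "\<And>T. finite T \<Longrightarrow> card T = k \<Longrightarrow> a T \<in> Z"
    and far: "\<And>T T' t. finite T \<Longrightarrow> card T = k \<Longrightarrow> finite T' \<Longrightarrow> card T' = k \<Longrightarrow> t \<in> T - T' \<Longrightarrow>
      e \<le> hausdorff_dist ((f ^^ (2 * t)) ` a T) ((f ^^ (2 * t)) ` a T')"
  shows "n div 2 choose k \<le> sep_number Z hausdorff_dist (image f) n \<epsilon>"
proof -
  let ?I = "{T. T \<subseteq> {..<n div 2} \<and> card T = k}"
  obtain K :: real and \<phi> :: "nat \<Rightarrow> real \<Rightarrow> int" where K: "K > 0" and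
    mono: "\<And>n. mono_on {0..1} (\<phi> n)" and
    fin: "\<And>n. finite (\<phi> n ` {0..1})" and
    card: "\<And>n. n > 0 \<Longrightarrow> real (card (\<phi> n ` {0..1})) \<le> K * real n" and
    small: "\<And>n A B. n > 0 \<Longrightarrow> A \<subseteq> {0..1} \<Longrightarrow> B \<subseteq> {0..1} \<Longrightarrow> \<phi> n ` A = \<phi> n ` B \<Longrightarrow>
      dyn_dist hausdorff_dist (image f) n A B < \<epsilon>"
    by (rule set_code[OF assms(1)]) (rule that; blast)
  have fT: "finite T" if "T \<in> ?I" for T
    using that finite_subset by auto
  have "card ?I \<le> sep_number Z hausdorff_dist (image f) n \<epsilon>"
  proof (rule card_le_sep_number[where c = "(`) (\<phi> n)" and a = a])
    have "(`) (\<phi> n) ` Z \<subseteq> Pow (\<phi> n ` {0..1})"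
      using assms(4) by blast
    then show "finite ((`) (\<phi> n) ` Z)"
      using fin finite_Pow_iff finite_subset by metis
    show "dyn_dist hausdorff_dist (image f) n A B < \<epsilon>"
      if "A \<in> Z" "B \<in> Z" "\<phi> n ` A = \<phi> n ` B" for A B
      using small[of n A B] assms that by auto
    show "a ` ?I \<subseteq> Z"
      using a fT by blast
    fix T T' assume T: "T \<in> ?I" "T' \<in> ?I" "T \<noteq> T'"
    then have "\<not> T \<subseteq> T'"
      using card_subset_eq[OF fT[OF T(2)], of T] by auto
    then obtain t where t: "t \<in> T - T'"
      by auto
    then have "2 * t < n"
      using T by auto
    moreover have "e \<le> hausdorff_dist ((f ^^ (2 * t)) ` a T) ((f ^^ (2 * t)) ` a T')"
      by (rule far[OF fT[OF T(1)] _ fT[OF T(2)] _ t]) (use T in auto)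
    with assms(2) have "\<epsilon> \<le> hausdorff_dist ((f ^^ (2 * t)) ` a T) ((f ^^ (2 * t)) ` a T')"
      by (rule order_trans)
    ultimately show "\<epsilon> \<le> dyn_dist hausdorff_dist (image f) n (a T) (a T')"
      by (intro dyn_dist_ge[of "2 * t"]) (auto simp: funpow_image)
  qed auto
  then show ?thesis
    by (simp add: n_subsets)
qed

section \<open>Polynomial upper bounds\<close>

text \<open>The code of a set with at most k points has at most k elements, so it is the set of
  letters of a word of length k over an alphabet of at most K * n letters.\<close>

lemma symmetric_product_sep_number_le:
  assumes "\<epsilon> > 0"
  obtains K :: real where "K > 0"
    "\<And>n. n > 0 \<Longrightarrow> real (sep_number (symmetric_product k {0..1}) hausdorff_dist (image f) n \<epsilon>)
      \<le> (K * real n) ^ k"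
proof -
  obtain K :: real and \<phi> :: "nat \<Rightarrow> real \<Rightarrow> int" where K: "K > 0" and
    mono: "\<And>n. mono_on {0..1} (\<phi> n)" and
    fin: "\<And>n. finite (\<phi> n ` {0..1})" and
    card: "\<And>n. n > 0 \<Longrightarrow> real (card (\<phi> n ` {0..1})) \<le> K * real n" and
    small: "\<And>n A B. n > 0 \<Longrightarrow> A \<subseteq> {0..1} \<Longrightarrow> B \<subseteq> {0..1} \<Longrightarrow> \<phi> n ` A = \<phi> n ` B \<Longrightarrow>
      dyn_dist hausdorff_dist (image f) n A B < \<epsilon>"
    by (rule set_code[OF assms]) (rule that; blast)
  have "real (sep_number (symmetric_product k {0..1}) hausdorff_dist (image f) n \<epsilon>)
      \<le> (K * real n) ^ k" if n: "n > 0" for n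
  proof -
    let ?Z = "symmetric_product k {0..1::real}"
    let ?F = "\<phi> n ` {0..1}"
    let ?L = "{xs. set xs \<subseteq> ?F \<and> length xs = k}"
    have sub: "(`) (\<phi> n) ` ?Z \<subseteq> set ` ?L"
    proof
      fix B assume "B \<in> (`) (\<phi> n) ` ?Z"
      then obtain A where A: "B = \<phi> n ` A" "A \<noteq> {}" "A \<subseteq> {0..1}" "finite A" "card A \<le> k"
        unfolding symmetric_product_def by auto
      then obtain xs where xs: "set xs = B" "length xs = card B"
        by (metis finite_distinct_list distinct_card finite_imageI)
      have "B \<noteq> {}"
        using A by auto
      have "card B \<le> k"
        using A card_image_le[of A "\<phi> n"] by auto
      \<comment> \<open>Repeating the first letter pads a listing to length exactly k, so that the
        words are counted by a single power.\<close>
      then have "set (xs @ replicate (k - card B) (hd xs)) = B"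
        "length (xs @ replicate (k - card B) (hd xs)) = k"
        using xs hd_in_set[of xs] \<open>B \<noteq> {}\<close> by (auto simp: set_replicate_conv_if)
      moreover have "B \<subseteq> ?F"
        using A by auto
      ultimately show "B \<in> set ` ?L"
        by (metis (mono_tags, lifting) image_eqI mem_Collect_eq)
    qed
    have finL: "finite ?L"
      using finite_lists_length_eq[OF fin] .
    have "sep_number ?Z hausdorff_dist (image f) n \<epsilon> \<le> card ((`) (\<phi> n) ` ?Z)"
    proof (rule sep_number_le_card_code)
      show "finite ((`) (\<phi> n) ` ?Z)"
        by (rule finite_subset[OF sub finite_imageI[OF finL]])
    qed (use small[OF n] in \<open>auto simp: symmetric_product_def\<close>)
    also have "\<dots> \<le> card (set ` ?L)"
      by (rule card_mono[OF finite_imageI[OF finL] sub])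
    also have "\<dots> \<le> card ?L"
      using finL by (rule card_image_le)
    also have "\<dots> = card ?F ^ k"
      using card_lists_length_eq[OF fin] .
    finally have "real (sep_number ?Z hausdorff_dist (image f) n \<epsilon>) \<le> real (card ?F) ^ k"
      by (metis of_nat_le_iff of_nat_power)
    also have "\<dots> \<le> (K * real n) ^ k"
      using card[OF n] by (intro power_mono) auto
    finally show ?thesis .
  qed
  with K show ?thesis
    by (rule that)
qed

text \<open>Because the point code is monotone, the code of an interval consists of all attained
  values between the codes of its endpoints. This pair determines it, and there are at most (K *
  n)^2 pairs.\<close>

lemma continua_sep_number_le:
  assumes "\<epsilon> > 0"
  obtains K :: real where "K > 0"
    "\<And>n. n > 0 \<Longrightarrow> real (sep_number (continua {0..1}) hausdorff_dist (image f) n \<epsilon>)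
      \<le> (K * real n) ^ 2"
proof -
  obtain K :: real and \<phi> :: "nat \<Rightarrow> real \<Rightarrow> int" where K: "K > 0" and
    mono: "\<And>n. mono_on {0..1} (\<phi> n)" and
    fin: "\<And>n. finite (\<phi> n ` {0..1})" and
    card: "\<And>n. n > 0 \<Longrightarrow> real (card (\<phi> n ` {0..1})) \<le> K * real n" and
    small: "\<And>n A B. n > 0 \<Longrightarrow> A \<subseteq> {0..1} \<Longrightarrow> B \<subseteq> {0..1} \<Longrightarrow> \<phi> n ` A = \<phi> n ` B \<Longrightarrow>
      dyn_dist hausdorff_dist (image f) n A B < \<epsilon>"
    by (rule set_code[OF assms]) (rule that; blast)
  have "real (sep_number (continua {0..1}) hausdorff_dist (image f) n \<epsilon>)
      \<le> (K * real n) ^ 2" if n: "n > 0" for n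
  proof -
    let ?Z = "continua {0..1::real}"
    let ?F = "\<phi> n ` {0..1}"
    let ?h = "\<lambda>(u, v). {w \<in> ?F. u \<le> w \<and> w \<le> v}"
    have sub: "(`) (\<phi> n) ` ?Z \<subseteq> ?h ` (?F \<times> ?F)"
    proof
      fix B assume "B \<in> (`) (\<phi> n) ` ?Z"
      then obtain A where A: "B = \<phi> n ` A" "A \<in> ?Z"
        by auto
      have "connected A" "A \<noteq> {}" "A \<subseteq> {0..1}"
        using A(2) unfolding continua_def hyperspace_def by (auto dest: closedin_imp_subset)
      moreover have "compact A"
        using A(2) closedin_compact[of "{0..1::real}" A]
        unfolding continua_def hyperspace_def by auto
      ultimately obtain a b where ab: "A = {a..b}" "a \<le> b" "0 \<le> a" "b \<le> 1"
        using connected_compact_interval_1[of A] by auto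
      have "\<phi> n ` {a..b} = {w \<in> ?F. \<phi> n a \<le> w \<and> w \<le> \<phi> n b}" (is "?l = ?r")
      proof
        show "?l \<subseteq> ?r"
          using ab monotone_onD[OF mono] by auto
        show "?r \<subseteq> ?l"
        proof
          fix w assume "w \<in> ?r"
          then obtain z where z: "z \<in> {0..1}" "w = \<phi> n z" "\<phi> n a \<le> w" "w \<le> \<phi> n b"
            by auto
          \<comment> \<open>A point z outside the interval can still have its code in the range;
            monotonicity then squeezes that code onto the code of the nearer endpoint.\<close>
          consider "z < a" | "b < z" | "z \<in> {a..b}"
            by force
          then show "w \<in> ?l"
          proof cases
            case 1
            then have "w = \<phi> n a"
              using z ab monotone_onD[OF mono, of z a n] by auto
            then show ?thesis
              using ab by auto
          next
            case 2
            then have "w = \<phi> n b"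
              using z ab monotone_onD[OF mono, of b z n] by auto
            then show ?thesis
              using ab by auto
          qed (use z in auto)
        qed
      qed
      then have "B = ?h (\<phi> n a, \<phi> n b)"
        using A ab by simp
      moreover have "(\<phi> n a, \<phi> n b) \<in> ?F \<times> ?F"
        using ab by auto
      ultimately show "B \<in> ?h ` (?F \<times> ?F)"
        by (rule image_eqI)
    qed
    have finF: "finite (?F \<times> ?F)"
      using fin by blast
    have "sep_number ?Z hausdorff_dist (image f) n \<epsilon> \<le> card ((`) (\<phi> n) ` ?Z)"
    proof (rule sep_number_le_card_code)
      show "finite ((`) (\<phi> n) ` ?Z)"
        by (rule finite_subset[OF sub finite_imageI[OF finF]])
    qed (use small[OF n] in \<open>auto simp: continua_def hyperspace_def dest!: closedin_imp_subset\<close>)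
    also have "\<dots> \<le> card (?h ` (?F \<times> ?F))"
      by (rule card_mono[OF finite_imageI[OF finF] sub])
    also have "\<dots> \<le> card (?F \<times> ?F)"
      using finF by (rule card_image_le)
    also have "\<dots> = card ?F ^ 2"
      by (simp add: card_cartesian_product power2_eq_square)
    finally have "real (sep_number ?Z hausdorff_dist (image f) n \<epsilon>) \<le> real (card ?F) ^ 2"
      by (metis of_nat_le_iff of_nat_power)
    also have "\<dots> \<le> (K * real n) ^ 2"
      using card[OF n] by (intro power_mono) auto
    finally show ?thesis .
  qed
  with K show ?thesis
    by (rule that)
qed

end


subsection \<open>Homeomorphisms of the interval\<close>

lemma homeomorphism_monotone_interval_map:
  assumes "homeomorphism {0..1::real} {0..1} f g"
  shows "monotone_interval_map f"
proof
  show "f ` {0..1} \<subseteq> {0..1}"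
    using assms homeomorphism_image1 by blast
  have "continuous_on {0..1} f" "inj_on f {0..1}"
    using assms by (auto simp: homeomorphism_def intro: inj_on_inverseI)
  then have "strict_mono_on {0..1} f \<or> strict_antimono_on {0..1} f"
    using injective_eq_monotone_map[of "{0..1}" f] is_interval_cc by blast
  then show "mono_on {0..1} f \<or> antimono_on {0..1} f"
    unfolding monotone_on_def by (metis order.order_iff_strict)
qed

lemma homeomorphism_funpow_cancel:
  assumes "homeomorphism S S f g" "z \<in> S"
  shows "(f ^^ n) ((g ^^ n) z) = z"
proof (induction n)
  case (Suc n)
  have "(g ^^ n) z \<in> S"
    using assms by (induction n) (auto simp: homeomorphism_def)
  then have "f (g ((g ^^ n) z)) = (g ^^ n) z"
    using assms by (auto simp: homeomorphism_def)
  then show ?case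
    using Suc by (simp add: funpow_swap1)
qed auto

text \<open>The point y j reaches x at time 2 * j. At an earlier or later even time it sits at an
  iterate of x under g o g or f o f respectively. Both maps are monotone, so by
  \<open>mono_on_funpow_displacement\<close> it is then at least the smaller of the two first
  displacements away from x.\<close>

lemma backward_orbit:
  assumes fg: "homeomorphism {0..1::real} {0..1} f g" and x: "x \<in> {0..1}" "f (f x) \<noteq> x"
  obtains y :: "nat \<Rightarrow> real" and e where
    "e > 0" "\<And>j. y j \<in> {0..1}" "\<And>j. (f ^^ (2 * j)) (y j) = x"
    "\<And>i j. i \<noteq> j \<Longrightarrow> e \<le> \<bar>(f ^^ (2 * i)) (y j) - x\<bar>"
proof -
  interpret f: monotone_interval_map f
    by (rule homeomorphism_monotone_interval_map[OF fg])
  interpret g: monotone_interval_map g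
    by (rule homeomorphism_monotone_interval_map[OF homeomorphism_symD[OF fg]])
  define y where "y j = (g ^^ (2 * j)) x" for j
  define e where "e = min \<bar>(f ^^ 2) x - x\<bar> \<bar>(g ^^ 2) x - x\<bar>"
  \<comment> \<open>For e > 0 the map g o g must move x as well; if it fixed x, applying f o f would
    give f (f x) = x.\<close>
  have "(g ^^ 2) x \<noteq> x"
    using homeomorphism_funpow_cancel[OF fg x(1), of 2] x(2) by (auto simp: numeral_2_eq_2)
  then have "e > 0"
    using x unfolding e_def by (auto simp: numeral_2_eq_2)
  moreover have "y j \<in> {0..1}" for j
    unfolding y_def by (rule g.funpow_into[OF x(1)])
  moreover have yx: "(f ^^ (2 * j)) (y j) = x" for j
    unfolding y_def by (rule homeomorphism_funpow_cancel[OF fg x(1)])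
  moreover have "e \<le> \<bar>(f ^^ (2 * i)) (y j) - x\<bar>" if "i \<noteq> j" for i j
  proof (cases "i < j")
    case True
    define d where "d = j - i"
    have d: "j = i + d" "d \<ge> 1"
      using True unfolding d_def by linarith+
    have "y j = (g ^^ (2 * i)) ((g ^^ (2 * d)) x)"
      unfolding y_def d by (simp add: funpow_add)
    then have "(f ^^ (2 * i)) (y j) = ((g ^^ 2) ^^ d) x"
      using homeomorphism_funpow_cancel[OF fg g.funpow_into[OF x(1)]] by (simp add: funpow_mult)
    moreover have "\<bar>(g ^^ 2) x - x\<bar> \<le> \<bar>((g ^^ 2) ^^ d) x - x\<bar>"
      using g.funpow_into x d
      by (intro mono_on_funpow_displacement[OF g.funpow2_mono]) blast+
    ultimately show ?thesis
      unfolding e_def by simp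
  next
    case False
    define d where "d = i - j"
    have d: "i = d + j" "d \<ge> 1"
      using False that unfolding d_def by linarith+
    have "(f ^^ (2 * i)) (y j) = (f ^^ (2 * d)) ((f ^^ (2 * j)) (y j))"
    proof -
      have i2: "2 * i = 2 * d + 2 * j"
        unfolding d(1) by (rule distrib_left)
      show ?thesis
        unfolding i2 funpow_add o_apply ..
    qed
    also have "\<dots> = ((f ^^ 2) ^^ d) x"
      unfolding yx funpow_mult ..
    finally have "(f ^^ (2 * i)) (y j) = ((f ^^ 2) ^^ d) x" .
    moreover have "\<bar>(f ^^ 2) x - x\<bar> \<le> \<bar>((f ^^ 2) ^^ d) x - x\<bar>"
      using f.funpow_into x d
      by (intro mono_on_funpow_displacement[OF f.funpow2_mono]) blast+
    ultimately show ?thesis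
      unfolding e_def by simp
  qed
  ultimately show ?thesis
    by (rule that)
qed

text \<open>If x is not strictly between h p' and h q', it is far from the whole second image.
  Otherwise the roles are exchanged: x is an end of the first image, and the end of the second image
  beyond it is far from all of the first.\<close>

lemma hausdorff_dist_mono_interval_images_ge:
  fixes h :: "real \<Rightarrow> real"
  assumes h: "mono_on {0..1} h" and pq: "0 \<le> p" "p \<le> q" "q \<le> 1"
    and pq': "0 \<le> p'" "p' \<le> q'" "q' \<le> 1"
    and x: "x = h p \<or> x = h q"
    and far: "e \<le> \<bar>h p' - x\<bar>" "e \<le> \<bar>h q' - x\<bar>"
  shows "e \<le> hausdorff_dist (h ` {p..q}) (h ` {p'..q'})"
proof -
  have J: "h p \<le> h z \<and> h z \<le> h q" if "z \<in> {p..q}" for z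
    using that pq monotone_onD[OF h, of p z] monotone_onD[OF h, of z q] by auto
  have K: "h p' \<le> h z \<and> h z \<le> h q'" if "z \<in> {p'..q'}" for z
    using that pq' monotone_onD[OF h, of p' z] monotone_onD[OF h, of z q'] by auto
  have "h ` {p..q} \<subseteq> {h p..h q}" "h ` {p'..q'} \<subseteq> {h p'..h q'}"
    using J K by auto
  then have bdd: "bounded (h ` {p..q})" "bounded (h ` {p'..q'})"
    by (meson bounded_closed_interval bounded_subset)+
  have xJ: "x \<in> h ` {p..q}"
    using x pq by auto
  consider "x \<le> h p'" | "h q' \<le> x" | "h p' < x" "x < h q'"
    by linarith
  then show ?thesis
  proof cases
    case 1
    show ?thesis
      by (rule hausdorff_dist_ge[OF bdd xJ]) (use 1 far K pq' in \<open>force simp: dist_real_def\<close>)+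
  next
    case 2
    show ?thesis
      by (rule hausdorff_dist_ge[OF bdd xJ]) (use 2 far K pq' in \<open>force simp: dist_real_def\<close>)+
  next
    case 3
    \<comment> \<open>The witness is p' if x = h p and q' if x = h q, since the first image lies on
      the other side of x.\<close>
    have "\<exists>w\<in>{p', q'}. \<forall>z\<in>{p..q}. e \<le> dist (h w) (h z)"
      using x 3 far J by (force simp: dist_real_def)
    then obtain w where "w \<in> {p', q'}" "\<forall>z\<in>{p..q}. e \<le> dist (h w) (h z)"
      by blast
    then show ?thesis
      using pq pq' unfolding hausdorff_dist_commute[of "h ` {p..q}"]
      by (intro hausdorff_dist_ge[OF bdd(2,1), of "h w"]) auto
  qed
qed

text \<open>The set indexed by \<open>T\<close> returns to \<open>x\<close> exactly at the times \<open>2 * t\<close> with \<open>t \<in> T\<close>, so the sets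
  indexed by the \<open>k\<close>-element subsets of \<open>{..<n div 2}\<close> are separated within time \<open>n\<close>.\<close>

lemma homeomorphism_choose_le_sep_number:
  assumes fg: "homeomorphism {0..1::real} {0..1} f g" and x: "x \<in> {0..1}" "f (f x) \<noteq> x"
  obtains e where "e > 0"
    "\<And>k n \<epsilon> Z. k \<ge> 1 \<Longrightarrow> n > 0 \<Longrightarrow> 0 < \<epsilon> \<Longrightarrow> \<epsilon> \<le> e \<Longrightarrow>
      symmetric_product k {0..1} \<subseteq> Z \<Longrightarrow> Z \<subseteq> Pow {0..1} \<Longrightarrow>
      n div 2 choose k \<le> sep_number Z hausdorff_dist (image f) n \<epsilon>"
    "\<And>n \<epsilon>. n > 0 \<Longrightarrow> 0 < \<epsilon> \<Longrightarrow> \<epsilon> \<le> e \<Longrightarrow>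
      n div 2 choose 2 \<le> sep_number (continua {0..1}) hausdorff_dist (image f) n \<epsilon>"
proof -
  interpret monotone_interval_map f
    by (rule homeomorphism_monotone_interval_map[OF fg])
  obtain y :: "nat \<Rightarrow> real" and e where e: "e > 0" and y01: "\<And>j. y j \<in> {0..1}"
    and yx: "\<And>j. (f ^^ (2 * j)) (y j) = x"
    and far: "\<And>i j. i \<noteq> j \<Longrightarrow> e \<le> \<bar>(f ^^ (2 * i)) (y j) - x\<bar>"
    by (rule backward_orbit[OF assms]) (rule that; blast)
  \<comment> \<open>Leaving \<open>Z\<close> free lets one bound serve both the symmetric products
    and the full hyperspace.\<close>
  have fin_case: "n div 2 choose k \<le> sep_number Z hausdorff_dist (image f) n \<epsilon>"
    if k: "k \<ge> 1" and n: "n > 0" and \<epsilon>: "0 < \<epsilon>" "\<epsilon> \<le> e"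
      and Z: "symmetric_product k {0..1} \<subseteq> Z" "Z \<subseteq> Pow {0..1}" for k n \<epsilon> Z
  proof (rule choose_le_sep_number[OF \<epsilon> n Z(2), where a = "\<lambda>T. y ` T"])
    fix T :: "nat set" assume T: "finite T" "card T = k"
    then have "card (y ` T) \<le> k" "T \<noteq> {}"
      using k card_image_le[of T y] by auto
    then have "y ` T \<in> symmetric_product k {0..1}"
      unfolding symmetric_product_def using T y01 by auto
    then show "y ` T \<in> Z"
      using Z by blast
  next
    fix T T' :: "nat set" and t
    assume T: "finite T" "card T = k" "finite T'" "card T' = k" "t \<in> T - T'"
    have "T' \<noteq> {}"
      using T k by auto
    have "x \<in> (f ^^ (2 * t)) ` y ` T"
      using T by (auto simp: image_iff yx intro!: bexI[of _ t])
    then show "e \<le> hausdorff_dist ((f ^^ (2 * t)) ` y ` T) ((f ^^ (2 * t)) ` y ` T')"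
    proof (rule hausdorff_dist_ge[rotated 2])
      fix z assume "z \<in> (f ^^ (2 * t)) ` y ` T'"
      then obtain j where "j \<in> T'" "z = (f ^^ (2 * t)) (y j)"
        by auto
      moreover have "t \<noteq> j"
        using T \<open>j \<in> T'\<close> by auto
      ultimately show "e \<le> dist x z"
        using far by (simp add: dist_real_def abs_minus_commute)
    qed (use T \<open>T' \<noteq> {}\<close> in \<open>auto intro: finite_imp_bounded\<close>)
  qed
  have cont_case: "n div 2 choose 2 \<le> sep_number (continua {0..1}) hausdorff_dist (image f) n \<epsilon>"
    if n: "n > 0" and \<epsilon>: "0 < \<epsilon>" "\<epsilon> \<le> e" for n \<epsilon>
  proof (rule choose_le_sep_number[OF \<epsilon> n, where a = "\<lambda>T. {Min (y ` T)..Max (y ` T)}"])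
    show "continua {0..1::real} \<subseteq> Pow {0..1}"
      unfolding continua_def hyperspace_def by (auto dest!: closedin_imp_subset)
    have ends: "Min (y ` T) \<in> y ` T" "Max (y ` T) \<in> y ` T" "0 \<le> Min (y ` T)"
      "Min (y ` T) \<le> Max (y ` T)" "Max (y ` T) \<le> 1"
      if T: "finite T" "card T = 2" for T :: "nat set"
    proof -
      have "finite (y ` T)" "y ` T \<noteq> {}"
        using T by auto
      then show *: "Min (y ` T) \<in> y ` T" "Max (y ` T) \<in> y ` T"
        by (rule Min_in, rule Max_in)
      then show "0 \<le> Min (y ` T)" "Max (y ` T) \<le> 1"
        using y01 by force+
      show "Min (y ` T) \<le> Max (y ` T)"
        using * \<open>finite (y ` T)\<close> by (meson Min_le)
    qed
    show "{Min (y ` T)..Max (y ` T)} \<in> continua {0..1}" if "finite T" "card T = 2" for T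
      using ends[OF that] unfolding continua_def hyperspace_def
      by (auto intro!: closed_subset)
    fix T T' :: "nat set" and t
    assume T: "finite T" "card T = 2" "finite T'" "card T' = 2" "t \<in> T - T'"
    obtain s where s: "T = {t, s}"
      using T by (metis DiffD1 card_2_iff insert_commute insertE singletonD)
    \<comment> \<open>As T has only two elements, y t is an end of the hull. With more points it
      could be interior and leave no trace in the hull, hence k = 2 for continua.\<close>
    have "y t = Min (y ` T) \<or> y t = Max (y ` T)"
      unfolding s by (auto simp: min_def max_def)
    then have "x = (f ^^ (2 * t)) (Min (y ` T)) \<or> x = (f ^^ (2 * t)) (Max (y ` T))"
      using yx[of t] by auto
    moreover have "e \<le> \<bar>(f ^^ (2 * t)) z - x\<bar>" if "z \<in> y ` T'" for z
    proof -
      obtain j where "j \<in> T'" "z = y j"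
        using \<open>z \<in> y ` T'\<close> by blast
      then show ?thesis
        using far[of t j] T(5) by blast
    qed
    ultimately show "e \<le> hausdorff_dist ((f ^^ (2 * t)) ` {Min (y ` T)..Max (y ` T)})
        ((f ^^ (2 * t)) ` {Min (y ` T')..Max (y ` T')})"
      using ends[OF T(1,2)] ends[OF T(3,4)]
      by (intro hausdorff_dist_mono_interval_images_ge[OF funpow_even_mono, where x = x]) auto
  qed
  show ?thesis
    by (rule that[OF e fin_case cont_case])
qed

section \<open>The three entropies\<close>

theorem theoremA:
  fixes f :: "real \<Rightarrow> real"
  assumes "\<exists>g. homeomorphism {0..1} {0..1} f g"
    and "finite (NW {0..1} f)"
  shows "pol_entropy (continua {0..1}) hausdorff_dist (image f) = 2 \<and>
    (\<forall>k\<ge>1. pol_entropy (symmetric_product k {0..1}) hausdorff_dist (image f) = ereal (real k)) \<and>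
    pol_entropy (hyperspace {0..1}) hausdorff_dist (image f) = \<infinity>"
proof -
  obtain g where fg: "homeomorphism {0..1} {0..1} f g"
    using assms(1) by blast
  interpret monotone_interval_map f
    by (rule homeomorphism_monotone_interval_map[OF fg])
  obtain x where x: "x \<in> {0..1}" "f (f x) \<noteq> x"
  proof (rule ccontr)
    assume "\<not> thesis"
    then have fix2: "(f ^^ 2) x = x" if "x \<in> {0..1}" for x
      using that \<open>\<And>x. x \<in> {0..1} \<Longrightarrow> f (f x) \<noteq> x \<Longrightarrow> thesis\<close> by (auto simp: numeral_2_eq_2)
    \<comment> \<open>If f o f were the identity, x would lie both in U and in its image under
      \<open>f ^^ 2\<close> for every candidate U, so the whole interval would be
      non-wandering.\<close>
    have "\<not> wandering {0..1} f x" if x: "x \<in> {0..1}" for x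
    proof
      assume "wandering {0..1} f x"
      then obtain U where U: "x \<in> U" "(f ^^ 2) ` U \<inter> U = {}"
        unfolding wandering_def by (metis one_le_numeral)
      then show False
        using fix2[OF x] by (metis disjoint_iff imageI)
    qed
    then have "{0..1} \<subseteq> NW {0..1} f"
      unfolding NW_def by blast
    then show False
      using assms(2) infinite_Icc[of 0 "1::real", OF zero_less_one] finite_subset by blast
  qed
  obtain e where e: "e > 0" and
    lower: "\<And>k n \<epsilon> Z. k \<ge> 1 \<Longrightarrow> n > 0 \<Longrightarrow> 0 < \<epsilon> \<Longrightarrow> \<epsilon> \<le> e \<Longrightarrow>
      symmetric_product k {0..1} \<subseteq> Z \<Longrightarrow> Z \<subseteq> Pow {0..1} \<Longrightarrow>
      n div 2 choose k \<le> sep_number Z hausdorff_dist (image f) n \<epsilon>" and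
    lower2: "\<And>n \<epsilon>. n > 0 \<Longrightarrow> 0 < \<epsilon> \<Longrightarrow> \<epsilon> \<le> e \<Longrightarrow>
      n div 2 choose 2 \<le> sep_number (continua {0..1}) hausdorff_dist (image f) n \<epsilon>"
    by (rule homeomorphism_choose_le_sep_number[OF fg x]) (rule that; blast)
  have "pol_entropy (continua {0..1}) hausdorff_dist (image f) = ereal (real 2)"
  proof (rule pol_entropy_eqI[OF e])
    fix \<epsilon> :: real assume \<epsilon>: "0 < \<epsilon>" "\<epsilon> \<le> e"
    obtain K :: real where "K > 0"
      "\<And>n. n > 0 \<Longrightarrow> real (sep_number (continua {0..1}) hausdorff_dist (image f) n \<epsilon>)
        \<le> (K * real n) ^ 2"
      by (rule continua_sep_number_le[OF \<epsilon>(1)]) (rule that; blast)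
    then show "limsup (\<lambda>n. ereal (ln (real (sep_number (continua {0..1}) hausdorff_dist (image f) n \<epsilon>))
        / ln (real n))) = ereal (real 2)"
      using lower2 \<epsilon> by (intro limsup_eq_of_choose_le) auto
  qed
  moreover have "pol_entropy (symmetric_product k {0..1}) hausdorff_dist (image f) = ereal (real k)"
    if k: "k \<ge> 1" for k
  proof (rule pol_entropy_eqI[OF e])
    fix \<epsilon> :: real assume \<epsilon>: "0 < \<epsilon>" "\<epsilon> \<le> e"
    obtain K :: real where K: "K > 0"
      "\<And>n. n > 0 \<Longrightarrow> real (sep_number (symmetric_product k {0..1}) hausdorff_dist (image f) n \<epsilon>)
        \<le> (K * real n) ^ k"
      by (rule symmetric_product_sep_number_le[OF \<epsilon>(1), of k]) (rule that; blast)
    have "symmetric_product k {0..1::real} \<subseteq> Pow {0..1}"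
      unfolding symmetric_product_def by blast
    then show "limsup (\<lambda>n. ereal (ln (real (sep_number (symmetric_product k {0..1}) hausdorff_dist
        (image f) n \<epsilon>)) / ln (real n))) = ereal (real k)"
      using lower[OF k] \<epsilon> by (intro limsup_eq_of_choose_le[OF k _ K]) auto
  qed
  moreover have "pol_entropy (hyperspace {0..1}) hausdorff_dist (image f) = \<infinity>"
  proof (rule pol_entropy_eqI[OF e])
    fix \<epsilon> :: real assume \<epsilon>: "0 < \<epsilon>" "\<epsilon> \<le> e"
    let ?L = "limsup (\<lambda>n. ereal (ln (real (sep_number (hyperspace {0..1}) hausdorff_dist (image f) n \<epsilon>))
        / ln (real n)))"
    \<comment> \<open>\<open>e\<close> was fixed before k and the hyperspace contains every
      symmetric product, so at each single \<epsilon> the limsup is at least k for every k.\<close>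
    have ge: "ereal (real k) \<le> ?L" if k: "k \<ge> 1" for k
    proof (rule limsup_ge_of_choose_le[OF k])
      have "symmetric_product k {0..1::real} \<subseteq> hyperspace {0..1}"
        unfolding symmetric_product_def hyperspace_def
        by (auto intro!: closed_subset finite_imp_closed)
      moreover have "hyperspace {0..1::real} \<subseteq> Pow {0..1}"
        unfolding hyperspace_def by (auto dest!: closedin_imp_subset)
      ultimately show "n div 2 choose k
          \<le> sep_number (hyperspace {0..1}) hausdorff_dist (image f) n \<epsilon>" if "n > 0" for n
        using lower[OF k that] \<epsilon> by auto
    qed
    show "?L = \<infinity>"
    proof (rule ereal_top)
      fix B :: real
      obtain k where "B \<le> real k"
        using real_arch_simple by blast
      \<comment> \<open>\<open>Suc k\<close> because \<open>ge\<close> asks for a positive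
        exponent.\<close>
      then have "ereal B \<le> ereal (real (Suc k))"
        by simp
      also have "\<dots> \<le> ?L"
        by (rule ge) simp
      finally show "ereal B \<le> ?L" .
    qed
  qed
  ultimately show ?thesis
    by simp
qed

end
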